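(* Let $d\in\mathbb{N}$, $d\ge 1$, and let $K\colon\mathbb{R}^d\times\mathbb{R}^d\to\mathbb{R}$ be a radial kernel, $K(x,y)=F(\|x-y\|)$, with basis function $F\colon\mathbb{R}_{\ge 0}\to\mathbb{R}$. Assume that $F$ is an analytic function with globally convergent Taylor series at $0$, i.e. there are $a_n\in\mathbb{R}$ with $$F(x)=\sum_{n=0}^\infty a_n x^n\qquad\text{for all }x\ge 0.$$ Then $$K(x,y)=\mathbb{E}_{\xi\sim\mathcal{U}_{\mathbb{S}^{d-1}}}\big[\mathrm{k}(\langle\xi,x\rangle,\langle\xi,y\rangle)\big]\qquad\text{for all }x,y\in\mathbb{R}^d,$$ where $\mathrm{k}\colon\mathbb{R}\times\mathbb{R}\to\mathbb{R}$ is the radial kernel $\mathrm{k}(s,t)=f(|s-t|)$ with basis function $f\colon\mathbb{R}_{\ge 0}\to\mathbb{R}$ given by the (everywhere convergent) power series $$f(x)=\sum_{n=0}^\infty b_n x^n,\qquad b_n=\frac{\sqrt{\pi}\,\Gamma\big(\frac{n+d}{2}\big)}{\Gamma\big(\frac{d}{2}\big)\Gamma\big(\frac{n+1}{2}\big)}\,a_n .$$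
   Context: $\|\cdot\|$ is the Euclidean norm, $\mathbb{S}^{d-1}=\{\xi\in\mathbb{R}^d:\|\xi\|=1\}$, and $\mathcal{U}_{\mathbb{S}^{d-1}}$ is the uniform probability distribution on $\mathbb{S}^{d-1}$. A kernel $K\colon\mathbb{R}^d\times\mathbb{R}^d\to\mathbb{R}$ is called radial with basis function $F\colon\mathbb{R}_{\ge 0}\to\mathbb{R}$ if $K(x,y)=F(\|x-y\|)$ for all $x,y$. $\Gamma$ is the Gamma function. *)

theory Defs
  imports "HOL-Probability.Probability"
begin

text \<open>
  Basis functions live on the nonnegative reals; they are rendered as functions on all reals of
  which only the values at nonnegative arguments matter. On the type of reals the norm is the
  absolute value, so this covers both the kernel on Euclidean space and the one on the reals.
\<close>

definition radial_kernel ::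
    "('a::euclidean_space \<Rightarrow> 'a \<Rightarrow> real) \<Rightarrow> (real \<Rightarrow> real) \<Rightarrow> bool" where
  "radial_kernel K F \<longleftrightarrow> (\<forall>x y. K x y = F (norm (x - y)))"

text \<open>
  The normalised surface measure of the unit sphere, obtained as the law of the direction
  (\<^const>\<open>sgn\<close> maps x to x / norm x) of a uniformly distributed point of the unit ball.
  The origin, the only point not sent to the sphere, has measure zero. In dimension one this
  is the fair coin on 1 and -1.
\<close>

definition uniform_sphere :: "'a::euclidean_space measure" where
  "uniform_sphere =
     restrict_space (distr (uniform_measure lborel (ball 0 1)) borel sgn) (sphere 0 1)"

lemma space_uniform_sphere: "space uniform_sphere = sphere 0 1"
  by (simp add: uniform_sphere_def space_restrict_space)

lemma sets_uniform_sphere: "sets uniform_sphere = sets (restrict_space borel (sphere 0 1))"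
  unfolding uniform_sphere_def by (intro sets_restrict_space_cong) simp

lemma emeasure_lborel_unit_ball:
  "emeasure lborel (ball 0 1 :: 'a::euclidean_space set) \<noteq> 0"
  "emeasure lborel (ball 0 1 :: 'a::euclidean_space set) \<noteq> \<infinity>"
proof -
  have "emeasure lborel (ball 0 1 :: 'a set) = ennreal (unit_ball_vol (real DIM('a)))"
    by (simp add: emeasure_ball)
  then show "emeasure lborel (ball 0 1 :: 'a set) \<noteq> 0" "emeasure lborel (ball 0 1 :: 'a set) \<noteq> \<infinity>"
    using unit_ball_vol_pos[of "real DIM('a)"] by (simp_all add: ennreal_eq_0_iff not_le)
qed

lemma emeasure_uniform_sphere:
  fixes A :: "'a::euclidean_space set"
  assumes "A \<in> sets borel" "A \<subseteq> sphere 0 1"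
  shows "emeasure uniform_sphere A =
    emeasure lborel {x \<in> ball 0 1. sgn x \<in> A} / emeasure lborel (ball 0 1 :: 'a set)"
proof -
  have "emeasure uniform_sphere A =
      emeasure (distr (uniform_measure lborel (ball 0 1)) borel sgn) A"
    unfolding uniform_sphere_def using assms(2)
    by (intro emeasure_restrict_space) auto
  also have "\<dots> = emeasure (uniform_measure lborel (ball 0 1)) (sgn -` A)"
    using assms(1) by (subst emeasure_distr) auto
  also have "\<dots> = emeasure lborel (ball 0 1 \<inter> sgn -` A) / emeasure lborel (ball 0 1 :: 'a set)"
    using measurable_sets[OF borel_measurable_sgn assms(1)]
    by (intro emeasure_uniform_measure) auto
  also have "ball 0 1 \<inter> sgn -` A = {x \<in> ball 0 1. sgn x \<in> A}" by auto
  finally show ?thesis .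
qed

lemma prob_space_uniform_sphere:
  "prob_space (uniform_sphere :: 'a::euclidean_space measure)"
proof
  have "{x \<in> ball 0 1. sgn x \<in> sphere 0 1} = ball 0 1 - {0 :: 'a}"
    by (auto simp: norm_sgn)
  moreover have "emeasure lborel (ball 0 1 - {0 :: 'a}) = emeasure lborel (ball 0 1 :: 'a set)"
    by (intro emeasure_Diff_null_set) auto
  ultimately show "emeasure (uniform_sphere :: 'a measure) (space uniform_sphere) = 1"
    using emeasure_lborel_unit_ball[where 'a = 'a]
    by (simp add: space_uniform_sphere emeasure_uniform_sphere ennreal_divide_self top.not_eq_extremum)
qed

lemma uniform_sphere_orthogonal_invariant:
  fixes T :: "real ^ 'n::{finite,wellorder} \<Rightarrow> real ^ 'n::{finite,wellorder}"
  assumes T: "orthogonal_transformation T"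
  shows "distr uniform_sphere uniform_sphere T = uniform_sphere"
proof (rule measure_eqI)
  have T_cont: "continuous_on UNIV T"
    using T by (intro linear_continuous_on linear_conv_bounded_linear[THEN iffD1])
      (auto simp: orthogonal_transformation)
  then have [measurable]: "T \<in> borel_measurable borel"
    by (rule borel_measurable_continuous_onI)
  have normT: "norm (T x) = norm x" for x
    using T by (simp add: orthogonal_transformation)
  have sgnT: "T (sgn x) = sgn (T x)" for x
    using T by (simp add: sgn_div_norm normT orthogonal_transformation linear_cmul)
  have meas: "T \<in> measurable uniform_sphere uniform_sphere"
    unfolding measurable_cong_sets[OF sets_uniform_sphere sets_uniform_sphere]
    by (intro measurable_restrict_space3) (auto simp: normT)
  fix A assume "A \<in> sets (distr uniform_sphere uniform_sphere T)"
  then have A: "A \<in> sets borel" "A \<subseteq> sphere 0 1"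
    by (auto simp: sets_uniform_sphere sets_restrict_space)
  have TA: "T -` A \<in> sets borel" "T -` A \<subseteq> sphere 0 1"
    using A measurable_sets[of T borel borel A] by (auto simp: normT vimage_def subset_eq)
  define S where "S = {x \<in> ball 0 1. sgn x \<in> A}"
  define S' where "S' = {x \<in> ball 0 1. sgn x \<in> T -` A}"
  have S: "S \<in> sets borel" and S': "S' \<in> sets borel"
  proof -
    have "S = ball 0 1 \<inter> sgn -` A" "S' = ball 0 1 \<inter> sgn -` (T -` A)"
      by (auto simp: S_def S'_def)
    then show "S \<in> sets borel" "S' \<in> sets borel"
      using measurable_sets[OF borel_measurable_sgn A(1)] measurable_sets[OF borel_measurable_sgn TA(1)]
      by (simp_all add: sets.Int)
  qed
  have "T ` S' = S"
  proof
    show "T ` S' \<subseteq> S" by (auto simp: S_def S'_def normT sgnT)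
    show "S \<subseteq> T ` S'"
    proof
      fix y assume y: "y \<in> S"
      obtain x where "y = T x"
        using orthogonal_transformation_surj[OF T] by (metis surjD)
      with y show "y \<in> T ` S'" by (auto simp: S_def S'_def normT sgnT)
    qed
  qed
  moreover have "S' \<in> lmeasurable"
    using S' by (intro bounded_set_imp_lmeasurable bounded_subset[OF bounded_ball[of 0 1]])
      (auto simp: S'_def)
  ultimately have "S \<in> lmeasurable" "measure lebesgue S = measure lebesgue S'"
    using measurable_orthogonal_image[OF T] measure_orthogonal_image[OF T] by auto
  then have "emeasure lebesgue S = emeasure lebesgue S'"
    using \<open>S' \<in> lmeasurable\<close> by (simp add: emeasure_eq_measure2 fmeasurableD2)
  then have "emeasure lborel S = emeasure lborel S'"
    using S S' by simp
  moreover have "emeasure (distr uniform_sphere uniform_sphere T) A = emeasure uniform_sphere (T -` A)"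
    using A TA meas by (subst emeasure_distr)
      (auto simp: sets_uniform_sphere sets_restrict_space space_uniform_sphere Int_absorb2)
  ultimately show "emeasure (distr uniform_sphere uniform_sphere T) A = emeasure uniform_sphere A"
    using A TA by (simp add: emeasure_uniform_sphere S_def S'_def)
qed simp

end

theory Submission
  imports Defs
begin

text \<open>
  For a unit vector u of a d-dimensional space, the n-th absolute moment c n of the inner product of
  u with a uniform point of the sphere is found by integrating |<x,u>|^n against the Gaussian
  density exp (- |x|^2) / pi^(d/2) in two ways. In Cartesian coordinates <x,u> is again a centred
  normal variable, as a sum of independent ones; in polar coordinates the direction and the radius
  separate. Comparing with the case n = 0 gives the quotient of Gamma values that relates a and b,
  namely b n = a n / c n, so the theorem is termwise integration of the power series of f. The
  convergence needed for this follows from Jensen's inequality c n >= (c 1)^n, which bounds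
  |b n x^n| by |a n| (|x| / c 1)^n without any asymptotics of the Gamma function.
\<close>

section \<open>Gaussian moments on the half-line\<close>

text \<open>The known Gaussian moments split by parity and have factorial values; these are values
  of Gamma at half-integers for even \<open>m\<close> and at integers for odd
  \<open>m\<close>.\<close>

lemma nn_integral_gaussian_half_moment:
  "(\<integral>\<^sup>+x. ennreal (exp (- x\<^sup>2) * x ^ m) * indicator {0..} x \<partial>lborel) =
     ennreal (Gamma ((real m + 1) / 2) / 2)"
proof -
  \<comment> \<open>Both sides obey the recursion with factor \<open>k + 1/2\<close>, starting from
    \<open>Gamma (1/2) = sqrt pi\<close>.\<close>
  have even: "sqrt pi / 2 * (fact (2 * k) / (2 ^ (2 * k) * fact k)) = Gamma (real k + 1/2) / 2" for k :: nat
  proof (induction k)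
    case 0
    then show ?case by (simp add: Gamma_one_half_real)
  next
    case (Suc k)
    have "sqrt pi / 2 * (fact (2 * Suc k) / (2 ^ (2 * Suc k) * fact (Suc k))) =
      (real k + 1/2) * (sqrt pi / 2 * (fact (2 * k) / (2 ^ (2 * k) * fact k)))"
      by (simp add: divide_simps) (simp add: algebra_simps)
    also have "\<dots> = (real k + 1/2) * (Gamma (real k + 1/2) / 2)"
      by (simp only: Suc)
    also have "\<dots> = Gamma (real k + 1/2 + 1) / 2"
      by (subst Gamma_plus1) (auto elim!: nonpos_Ints_cases)
    finally show ?case by (simp add: add_ac)
  qed
  have "has_bochner_integral lborel (\<lambda>x::real. indicator {0..} x *\<^sub>R (exp (-x\<^sup>2)*x^m)) (Gamma ((real m + 1) / 2) / 2)"
  proof (cases "even m")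
    case True
    then obtain k where "m = 2 * k" by (elim evenE)
    then show ?thesis
      using gaussian_moment_even_pos[of k] by (simp only: even) (simp add: add_divide_distrib)
  next
    case False
    then obtain k where "m = 2 * k + 1" by (elim oddE)
    then have m: "m = 2 * k + 1" "(real m + 1) / 2 = 1 + real k" by simp_all
    show ?thesis
      using gaussian_moment_odd_pos[of k] Gamma_fact[of k, where 'a = real]
      by (simp only: m(2)) (simp add: m(1))
  qed
  then have "(\<integral>\<^sup>+x. ennreal (indicator {0..} x *\<^sub>R (exp (-x\<^sup>2)*x^m)) \<partial>lborel) = ennreal (Gamma ((real m + 1) / 2) / 2)"
    by (subst nn_integral_eq_integral)
      (auto simp: has_bochner_integral_iff indicator_def)
  also have "(\<integral>\<^sup>+x. ennreal (indicator {0..} x *\<^sub>R (exp (-x\<^sup>2)*x^m)) \<partial>lborel) =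
     (\<integral>\<^sup>+x. ennreal (exp (- x\<^sup>2) * x ^ m) * indicator {0..} x \<partial>lborel)"
    by (intro nn_integral_cong) (auto simp: indicator_def)
  finally show ?thesis .
qed

section \<open>Integration in polar coordinates\<close>

lemma nn_integral_polar:
  fixes \<phi> :: "'a::euclidean_space \<Rightarrow> ennreal"
  assumes [measurable]: "\<phi> \<in> borel_measurable borel" "h \<in> borel_measurable borel"
    and hom: "\<And>r x. 0 < r \<Longrightarrow> \<phi> (r *\<^sub>R x) = \<phi> x"
    and fin: "(\<integral>\<^sup>+x. \<phi> x * indicator (ball 0 1) x \<partial>lborel) \<noteq> \<infinity>"
  shows "(\<integral>\<^sup>+x. \<phi> x * h (norm x) \<partial>lborel) =
    (\<integral>\<^sup>+x. \<phi> x * indicator (ball 0 1) x \<partial>lborel) *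
    (\<integral>\<^sup>+r. ennreal (real DIM('a) * r ^ (DIM('a) - 1)) * h r * indicator {0..} r \<partial>lborel)"
proof -
  \<comment> \<open>The law of the norm under the measure with density \<phi> is determined by the balls around 0,
    whose mass scales like the power DIM('a) of the radius.\<close>
  define V where "V = (\<integral>\<^sup>+x. \<phi> x * indicator (ball 0 1) x \<partial>lborel)"
  \<comment> \<open>The claimed density of the radius: for positive \<open>r\<close> the derivative
    of \<open>V * r ^ DIM('a)\<close>.\<close>
  define w where "w r = V * ennreal (real DIM('a) * r ^ (DIM('a) - 1)) * indicator {0..} r" for r
  have [measurable]: "w \<in> borel_measurable borel"
    unfolding w_def by measurable
  have ball: "norm -` {..<a} = ball (0 :: 'a) a" for a
    by auto
  have [measurable]: "ball (0 :: 'a) a \<in> sets borel" for a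
    by (intro borel_open open_ball)
  let ?M = "distr (density lborel \<phi>) borel norm"
  \<comment> \<open>Writing \<open>max 0 a\<close> lets one formula also cover
    \<open>a \<le> 0\<close>, where the ball is empty.\<close>
  have M: "emeasure ?M {..<a} = ennreal (max 0 a ^ DIM('a)) * V" for a
  proof (cases "a > 0")
    case True
    have "emeasure ?M {..<a} = (\<integral>\<^sup>+x. \<phi> x * indicator (ball 0 a) x \<partial>lborel)"
      by (subst emeasure_distr) (simp_all add: emeasure_density ball)
    \<comment> \<open>Substituting \<open>a *\<^sub>R x\<close> for \<open>x\<close> scales Lebesgue
      measure by \<open>a ^ DIM('a)\<close>, while \<open>hom\<close> removes the factor
      \<open>a\<close> from the argument of \<open>\<phi>\<close>.\<close>
    also have "\<dots> = (\<integral>\<^sup>+x. \<phi> x * indicator (ball 0 a) x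
        \<partial>density (distr lborel borel (\<lambda>x. 0 + a *\<^sub>R x)) (\<lambda>_. \<bar>a\<bar> ^ DIM('a)))"
      using True by (subst lborel_affine[of a 0]) auto
    also have "\<dots> = (\<integral>\<^sup>+x. ennreal (\<bar>a\<bar> ^ DIM('a)) * (\<phi> (0 + a *\<^sub>R x) * indicator (ball 0 a) (0 + a *\<^sub>R x)) \<partial>lborel)"
      by (subst nn_integral_density) (simp_all add: nn_integral_distr)
    also have "\<dots> = (\<integral>\<^sup>+x. ennreal (a ^ DIM('a)) * (\<phi> x * indicator (ball 0 1) x) \<partial>lborel)"
      using True by (intro nn_integral_cong) (auto simp: indicator_def hom)
    also have "\<dots> = ennreal (max 0 a ^ DIM('a)) * V"
      using True by (simp add: nn_integral_cmult V_def)
    finally show ?thesis .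
  next
    case False
    then show ?thesis by (subst emeasure_distr) (simp_all add: ball ball_empty)
  qed
  have N: "emeasure (density lborel w) {..<a} = ennreal (max 0 a ^ DIM('a)) * V" for a
  proof -
    have "emeasure (density lborel w) {..<a} = (\<integral>\<^sup>+r. w r * indicator {..<a} r \<partial>lborel)"
      by (simp add: emeasure_density)
    \<comment> \<open>The integrands can differ only at \<open>a\<close> (if \<open>a > 0\<close>)
      or at \<open>0\<close> (if \<open>a \<le> 0\<close>); the closed interval suits the
      fundamental theorem of calculus.\<close>
    also have "\<dots> = (\<integral>\<^sup>+r. V * (ennreal (real DIM('a) * r ^ (DIM('a) - 1)) * indicator {0..max 0 a} r) \<partial>lborel)"
      using AE_lborel_singleton[of a] AE_lborel_singleton[of "0::real"]
      by (intro nn_integral_cong_AE) (auto simp: w_def indicator_def)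
    also have "\<dots> = V * (\<integral>\<^sup>+r. ennreal (real DIM('a) * r ^ (DIM('a) - 1)) * indicator {0..max 0 a} r \<partial>lborel)"
      by (subst nn_integral_cmult) simp_all
    also have "(\<integral>\<^sup>+r. ennreal (real DIM('a) * r ^ (DIM('a) - 1)) * indicator {0..max 0 a} r \<partial>lborel) =
        ennreal (max 0 a ^ DIM('a) - 0 ^ DIM('a))"
      by (intro nn_integral_FTC_Icc) (auto intro!: derivative_eq_intros)
    finally show ?thesis by (simp add: mult.commute zero_power)
  qed
  \<comment> \<open>The half-lines \<open>{..<a}\<close> are stable under intersection and generate
    the Borel sets; \<open>fin\<close> gives the exhausting ones finite mass.\<close>
  have "?M = density lborel w"
  proof (rule measure_eqI_generator_eq)
    show "Int_stable (range lessThan :: real set set)"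
    proof (rule Int_stableI_image)
      show "\<exists>c\<in>UNIV. {..<a} \<inter> {..<b} = {..<c}" for a b :: real
        by (intro bexI[of _ "min a b"]) auto
    qed
    show "sets ?M = sigma_sets UNIV (range lessThan)" "sets (density lborel w) = sigma_sets UNIV (range lessThan)"
      by (simp_all add: borel_Iio)
    show "range (\<lambda>n. {..<real n}) \<subseteq> range lessThan" by auto
    show "(\<Union>n. {..<real n}) = UNIV" using reals_Archimedean2 by blast
    show "emeasure ?M {..<real n} \<noteq> \<infinity>" for n
      using fin by (simp add: M V_def ennreal_mult_eq_top_iff)
  qed (auto simp: M N)
  then have "(\<integral>\<^sup>+r. h r \<partial>?M) = (\<integral>\<^sup>+r. h r \<partial>density lborel w)" by simp
  also have "(\<integral>\<^sup>+r. h r \<partial>?M) = (\<integral>\<^sup>+x. \<phi> x * h (norm x) \<partial>lborel)"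
    by (simp add: nn_integral_distr nn_integral_density)
  also have "(\<integral>\<^sup>+r. h r \<partial>density lborel w) =
      (\<integral>\<^sup>+r. V * (ennreal (real DIM('a) * r ^ (DIM('a) - 1)) * h r * indicator {0..} r) \<partial>lborel)"
    by (simp add: nn_integral_density w_def mult_ac)
  also have "\<dots> = V * (\<integral>\<^sup>+r. ennreal (real DIM('a) * r ^ (DIM('a) - 1)) * h r * indicator {0..} r \<partial>lborel)"
    by (subst nn_integral_cmult) simp_all
  finally show ?thesis by (simp add: V_def)
qed


section \<open>The isotropic normal distribution\<close>

text \<open>For positive \<open>\<sigma>\<close> the centred normal law with covariance
  \<open>\<sigma>\<^sup>2\<close> times the identity, kept as a product over coordinates so that the
  measure of a box factors.\<close>

definition iso_normal :: "real \<Rightarrow> 'a::euclidean_space measure" where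
  "iso_normal \<sigma> = density lborel (\<lambda>x. \<Prod>b\<in>Basis. ennreal (normal_density 0 \<sigma> (x \<bullet> b)))"

lemma sets_iso_normal [simp, measurable_cong]: "sets (iso_normal \<sigma>) = sets borel"
  and space_iso_normal [simp]: "space (iso_normal \<sigma>) = UNIV"
  by (simp_all add: iso_normal_def)

text \<open>Density and indicator of a box are both products of functions of single coordinates, so
  the integral factors by Tonelli. Total mass, marginals and independence are all read off from
  this.\<close>

lemma emeasure_iso_normal_box:
  fixes A :: "'a::euclidean_space \<Rightarrow> real set"
  assumes [measurable]: "\<And>b. A b \<in> sets borel"
  shows "emeasure (iso_normal \<sigma>) (\<Inter>b\<in>Basis. (\<lambda>x. x \<bullet> b) -` A b) =
    (\<Prod>b\<in>Basis. emeasure (density lborel (normal_density 0 \<sigma>)) (A b))"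
proof -
  have [measurable]: "(\<lambda>x::'a. x \<bullet> b) -` A b \<in> sets borel" for b
    using measurable_sets[of "\<lambda>x::'a. x \<bullet> b" borel borel "A b"] by simp
  have "emeasure (iso_normal \<sigma>) (\<Inter>b\<in>Basis. (\<lambda>x. x \<bullet> b) -` A b) =
      (\<integral>\<^sup>+x. (\<Prod>b\<in>Basis. ennreal (normal_density 0 \<sigma> (x \<bullet> b))) *
        indicator (\<Inter>b\<in>Basis. (\<lambda>x. x \<bullet> b) -` A b) x \<partial>(lborel :: 'a measure))"
    unfolding iso_normal_def by (intro emeasure_density) (auto intro!: sets.finite_INT)
  also have "\<dots> = (\<integral>\<^sup>+x. (\<Prod>b\<in>Basis. ennreal (normal_density 0 \<sigma> (x \<bullet> b)) * indicator (A b) (x \<bullet> b))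
        \<partial>(lborel :: 'a measure))"
  proof (intro nn_integral_cong)
    fix x :: 'a
    have "indicator (\<Inter>b\<in>Basis. (\<lambda>x. x \<bullet> b) -` A b) x = (\<Prod>b\<in>Basis. indicator (A b) (x \<bullet> b) :: ennreal)"
      by (auto simp: indicator_def prod_zero_iff)
    then show "(\<Prod>b\<in>Basis. ennreal (normal_density 0 \<sigma> (x \<bullet> b))) *
        indicator (\<Inter>b\<in>Basis. (\<lambda>x. x \<bullet> b) -` A b) x =
        (\<Prod>b\<in>Basis. ennreal (normal_density 0 \<sigma> (x \<bullet> b)) * indicator (A b) (x \<bullet> b))"
      by (simp add: prod.distrib)
  qed
  also have "\<dots> = (\<Prod>b\<in>Basis. \<integral>\<^sup>+t. ennreal (normal_density 0 \<sigma> t) * indicator (A b) t \<partial>lborel)"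
    by (intro nn_integral_lborel_prod) auto
  finally show ?thesis by (simp add: emeasure_density)
qed

lemma prob_space_iso_normal:
  assumes "0 < \<sigma>"
  shows "prob_space (iso_normal \<sigma> :: 'a::euclidean_space measure)"
proof
  interpret prob_space "density lborel (normal_density 0 \<sigma>)"
    using assms by (rule prob_space_normal_density)
  show "emeasure (iso_normal \<sigma> :: 'a measure) (space (iso_normal \<sigma>)) = 1"
    using emeasure_iso_normal_box[of "\<lambda>_::'a. UNIV" \<sigma>] emeasure_space_1 by simp
qed

text \<open>An event about coordinate \<open>b\<close> is a box whose other sides are
  \<open>UNIV\<close>, each contributing mass 1.\<close>

lemma distributed_iso_normal_coordinate:
  fixes b :: "'a::euclidean_space"
  assumes \<sigma>: "0 < \<sigma>" and b: "b \<in> Basis"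
  shows "distributed (iso_normal \<sigma>) lborel (\<lambda>x. x \<bullet> b) (normal_density 0 \<sigma>)"
  unfolding distributed_def
proof (intro conjI measure_eqI)
  interpret prob_space "density lborel (normal_density 0 \<sigma>)"
    using \<sigma> by (rule prob_space_normal_density)
  fix A assume "A \<in> sets (distr (iso_normal \<sigma>) lborel (\<lambda>x. x \<bullet> b))"
  then have A: "A \<in> sets borel" by simp
  let ?A = "\<lambda>c. if c = b then A else UNIV"
  have "(\<lambda>x. x \<bullet> b) -` A = (\<Inter>c\<in>Basis. (\<lambda>x. x \<bullet> c) -` ?A c)"
    using b by (auto split: if_splits)
  then have "emeasure (distr (iso_normal \<sigma>) lborel (\<lambda>x. x \<bullet> b)) A =
      emeasure (iso_normal \<sigma>) (\<Inter>c\<in>Basis. (\<lambda>x. x \<bullet> c) -` ?A c)"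
    using A by (subst emeasure_distr) auto
  also have "\<dots> = (\<Prod>c\<in>Basis. emeasure (density lborel (normal_density 0 \<sigma>)) (?A c))"
    using A by (intro emeasure_iso_normal_box) auto
  also have "\<dots> = (\<Prod>c\<in>Basis. if c = b then emeasure (density lborel (normal_density 0 \<sigma>)) A else 1)"
    using emeasure_space_1 by (intro prod.cong) auto
  also have "\<dots> = emeasure (density lborel (normal_density 0 \<sigma>)) A"
    using b by (simp add: prod.delta)
  finally show "emeasure (distr (iso_normal \<sigma>) lborel (\<lambda>x. x \<bullet> b)) A =
      emeasure (density lborel (normal_density 0 \<sigma>)) A" .
qed auto

text \<open>The mass of a box is the product over its sides, and each factor is the mass of a
  marginal event.\<close>

lemma indep_vars_iso_normal:
  assumes \<sigma>: "0 < \<sigma>"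
  shows "prob_space.indep_vars (iso_normal \<sigma>) (\<lambda>_. borel) (\<lambda>b x. x \<bullet> b) (Basis :: 'a::euclidean_space set)"
proof -
  interpret prob_space "iso_normal \<sigma> :: 'a measure"
    using \<sigma> by (rule prob_space_iso_normal)
  show ?thesis
  proof (subst indep_vars_finite[where E = "\<lambda>_. sets borel"])
    show "\<forall>A\<in>(Basis::'a set) \<rightarrow> sets borel.
        prob (\<Inter>j\<in>Basis. (\<lambda>x. x \<bullet> j) -` A j \<inter> space (iso_normal \<sigma>)) =
        (\<Prod>j\<in>Basis. prob ((\<lambda>x. x \<bullet> j) -` A j \<inter> space (iso_normal \<sigma>)))"
    proof
      fix A assume A: "A \<in> (Basis::'a set) \<rightarrow> (sets borel :: real set set)"
      \<comment> \<open>\<open>A\<close> is known to be Borel only on \<open>Basis\<close>, while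
        the box formula wants this at every vector; hence the default \<open>{}\<close>.\<close>
      define B where "B b = (if b \<in> Basis then A b else {})" for b
      have B: "B b \<in> sets borel" for b using A by (auto simp: B_def)
      have "emeasure (iso_normal \<sigma>) (\<Inter>b\<in>Basis. (\<lambda>x. x \<bullet> b) -` B b) =
          (\<Prod>b\<in>Basis. emeasure (density lborel (normal_density 0 \<sigma>)) (B b))"
        using B by (rule emeasure_iso_normal_box)
      also have "\<dots> = (\<Prod>b\<in>Basis. emeasure (iso_normal \<sigma>) ((\<lambda>x. x \<bullet> b) -` B b))"
      proof (intro prod.cong refl)
        fix b :: 'a assume "b \<in> Basis"
        from distributed_distr_eq_density[OF distributed_iso_normal_coordinate[OF \<sigma> this]]
        show "emeasure (density lborel (normal_density 0 \<sigma>)) (B b) = emeasure (iso_normal \<sigma>) ((\<lambda>x. x \<bullet> b) -` B b)"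
          using emeasure_distr[of "\<lambda>x. x \<bullet> b" "iso_normal \<sigma>" lborel "B b"] B[of b] by simp
      qed
      finally have "prob (\<Inter>b\<in>Basis. (\<lambda>x. x \<bullet> b) -` B b) = (\<Prod>b\<in>Basis. prob ((\<lambda>x. x \<bullet> b) -` B b))"
        by (simp add: emeasure_eq_measure prod_ennreal prod_nonneg)
      then show "prob (\<Inter>j\<in>Basis. (\<lambda>x. x \<bullet> j) -` A j \<inter> space (iso_normal \<sigma>)) =
        (\<Prod>j\<in>Basis. prob ((\<lambda>x. x \<bullet> j) -` A j \<inter> space (iso_normal \<sigma>)))"
        by (simp add: B_def)
    qed
  qed (auto simp: sets.sigma_sets_eq[of borel, simplified] Int_stable_def)
qed

text \<open>\<open>x \<bullet> u\<close> is a sum of independent centred normal variables with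
  variances \<open>(u \<bullet> b)\<^sup>2 * \<sigma>\<^sup>2\<close>, which add up to
  \<open>\<sigma>\<^sup>2\<close> because \<open>u\<close> is a unit vector.\<close>

lemma distributed_iso_normal_inner:
  fixes u :: "'a::euclidean_space"
  assumes \<sigma>: "0 < \<sigma>" and u: "norm u = 1"
  shows "distributed (iso_normal \<sigma>) lborel (\<lambda>x. x \<bullet> u) (normal_density 0 \<sigma>)"
proof -
  interpret prob_space "iso_normal \<sigma> :: 'a measure"
    using \<sigma> by (rule prob_space_iso_normal)
  \<comment> \<open>Coordinates where \<open>u\<close> vanishes are dropped: they would contribute
    the constant 0, which has no density.\<close>
  define I where "I = {b\<in>Basis. u \<bullet> b \<noteq> 0}"
  have I: "finite I" "I \<subseteq> Basis" by (auto simp: I_def)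
  have sum_I: "(\<Sum>b\<in>I. g b) = (\<Sum>b\<in>Basis. g b)" if "\<And>b. u \<bullet> b = 0 \<Longrightarrow> g b = 0" for g :: "'a \<Rightarrow> real"
    using that by (intro sum.mono_neutral_left) (auto simp: I_def)
  have "(\<Sum>b\<in>Basis. (u \<bullet> b)\<^sup>2) = 1"
    using u norm_eq_1[of u] by (simp add: euclidean_inner[of u u] power2_eq_square)
  then have sum1: "(\<Sum>b\<in>I. (u \<bullet> b)\<^sup>2) = 1" by (simp add: sum_I)
  then have "I \<noteq> {}" by auto
  have ind: "indep_vars (\<lambda>_. borel) (\<lambda>b x. (u \<bullet> b) * (x \<bullet> b)) I"
    using indep_vars_subset[OF indep_vars_iso_normal[OF \<sigma>] I(2)]
    by (rule indep_vars_compose2) auto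
  have "distributed (iso_normal \<sigma>) lborel (\<lambda>x. (u \<bullet> b) * (x \<bullet> b)) (normal_density 0 (\<bar>u \<bullet> b\<bar> * \<sigma>))"
    if "b \<in> I" for b
    using that normal_density_affine[OF distributed_iso_normal_coordinate[OF \<sigma>, of b] \<sigma>, of "u \<bullet> b" 0]
    by (simp add: I_def)
  from sum_indep_normal[OF I(1) \<open>I \<noteq> {}\<close> ind _ this]
  have "distributed (iso_normal \<sigma>) lborel (\<lambda>x. \<Sum>b\<in>I. (u \<bullet> b) * (x \<bullet> b))
      (normal_density 0 (sqrt (\<Sum>b\<in>I. (\<bar>u \<bullet> b\<bar> * \<sigma>)\<^sup>2)))"
    using \<sigma> by (auto simp: I_def)
  also have "(\<lambda>x. \<Sum>b\<in>I. (u \<bullet> b) * (x \<bullet> b)) = (\<lambda>x. x \<bullet> u)"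
    by (simp add: sum_I euclidean_inner[of _ u] mult.commute)
  also have "(\<Sum>b\<in>I. (\<bar>u \<bullet> b\<bar> * \<sigma>)\<^sup>2) = \<sigma>\<^sup>2"
    using sum1 by (simp add: power_mult_distrib flip: sum_distrib_right)
  finally show ?thesis using \<sigma> by simp
qed


section \<open>The Gaussian integral evaluated in two ways\<close>

text \<open>Polar coordinates in dimension one: with \<open>\<phi> = 1\<close> the half-line moment
  is multiplied by 2, the length of the unit ball.\<close>

lemma nn_integral_gaussian_abs_moment:
  "(\<integral>\<^sup>+t. ennreal (exp (- t\<^sup>2) * \<bar>t\<bar> ^ n) \<partial>lborel) = ennreal (Gamma ((real n + 1) / 2))"
proof -
  have ball: "(\<integral>\<^sup>+t. 1 * indicator (ball 0 1) t \<partial>(lborel :: real measure)) = 2"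
    by (simp add: emeasure_ball unit_ball_vol_1)
  have "(\<integral>\<^sup>+t. 1 * ennreal (exp (- (norm t)\<^sup>2) * norm t ^ n) \<partial>(lborel :: real measure)) =
      2 * (\<integral>\<^sup>+r. ennreal (exp (- r\<^sup>2) * r ^ n) * indicator {0..} r \<partial>lborel)"
    by (subst nn_integral_polar) (simp_all only: ball, simp_all)
  also have "\<dots> = ennreal (Gamma ((real n + 1) / 2))"
    by (simp add: nn_integral_gaussian_half_moment ennreal_mult''[symmetric] flip: ennreal_numeral)
  finally show ?thesis by simp
qed

text \<open>The deviation \<open>sqrt (1/2)\<close> makes the exponent \<open>- x\<^sup>2\<close>,
  as in the moments above.\<close>

lemma normal_density_sqrt_half: "normal_density 0 (sqrt (1/2)) x = exp (- x\<^sup>2) / sqrt pi"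
  by (simp add: normal_density_def)

lemma prod_normal_density:
  fixes x :: "'a::euclidean_space"
  shows "(\<Prod>b\<in>Basis. ennreal (normal_density 0 (sqrt (1/2)) (x \<bullet> b))) =
     ennreal (exp (- (norm x)\<^sup>2) / sqrt pi ^ DIM('a))"
proof -
  have "(norm x)\<^sup>2 = (\<Sum>b\<in>Basis. (x \<bullet> b)\<^sup>2)"
    unfolding power2_norm_eq_inner euclidean_inner[of x x] by (simp add: power2_eq_square)
  then have "exp (- (norm x)\<^sup>2) = (\<Prod>b\<in>Basis. exp (- (x \<bullet> b)\<^sup>2))"
    by (simp add: exp_sum sum_negf flip: sum_negf)
  then show ?thesis
    by (simp add: normal_density_sqrt_half prod_ennreal prod_dividef)
qed

text \<open>The \<open>n\<close>-th absolute moment of \<open>x \<bullet> u\<close> under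
  \<open>iso_normal (sqrt (1/2))\<close> is computed twice. The normal law of
  \<open>x \<bullet> u\<close> gives \<open>Gamma ((n + 1) / 2) / sqrt pi\<close>; polar coordinates
  give the ball integral times a multiple of \<open>Gamma ((n + DIM('a)) / 2)\<close>.\<close>

lemma nn_integral_ball_sgn_inner_power:
  fixes u :: "'a::euclidean_space"
  assumes u: "norm u = 1"
  shows "(\<integral>\<^sup>+x. ennreal (\<bar>sgn x \<bullet> u\<bar> ^ n) * indicator (ball 0 1) x \<partial>lborel) =
    ennreal (2 * sqrt pi ^ DIM('a) / (sqrt pi * DIM('a)) *
      (Gamma ((real n + 1) / 2) / Gamma ((real n + DIM('a)) / 2)))"
proof -
  define d where "d = DIM('a)"
  have d: "0 < d" by (simp add: d_def)
  define I where "I = (\<integral>\<^sup>+x. ennreal (\<bar>sgn x \<bullet> u\<bar> ^ n) * indicator (ball 0 1) x \<partial>lborel)"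
  \<comment> \<open>The radial factor: Gaussian density times the \<open>n\<close>-th power of the
    norm.\<close>
  define h where "h r = ennreal (exp (- r\<^sup>2) / sqrt pi ^ d * \<bar>r\<bar> ^ n)" for r
  have [measurable]: "h \<in> borel_measurable borel"
    unfolding h_def by measurable
  have le1: "\<bar>sgn x \<bullet> u\<bar> \<le> 1" for x
    using Cauchy_Schwarz_ineq2[of "sgn x" u] u by (cases "x = 0") (auto simp: norm_sgn)
  \<comment> \<open>Finiteness of \<open>I\<close> is required by the polar formula and for solving
    the final equation in the reals.\<close>
  have "I \<le> (\<integral>\<^sup>+x. indicator (ball 0 1) x \<partial>(lborel :: 'a measure))"
    unfolding I_def using le1
    by (intro nn_integral_mono) (auto simp: indicator_def power_le_one)
  then have fin: "I \<noteq> \<infinity>"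
    using emeasure_lborel_unit_ball(2)[where 'a = 'a] by (auto simp: top_unique)
  have "ennreal (Gamma ((real n + 1) / 2) / sqrt pi) =
      (\<integral>\<^sup>+t. ennreal (1 / sqrt pi) * ennreal (exp (- t\<^sup>2) * \<bar>t\<bar> ^ n) \<partial>lborel)"
    by (subst nn_integral_cmult)
      (simp_all add: nn_integral_gaussian_abs_moment ennreal_mult''[symmetric])
  also have "\<dots> = (\<integral>\<^sup>+t. ennreal (normal_density 0 (sqrt (1/2)) t) * ennreal (\<bar>t\<bar> ^ n) \<partial>lborel)"
    by (simp add: normal_density_sqrt_half ennreal_mult''[symmetric] mult_ac)
  also have "\<dots> = (\<integral>\<^sup>+x. ennreal (\<bar>x \<bullet> u\<bar> ^ n) \<partial>iso_normal (sqrt (1/2)))"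
    using u by (intro distributed_nn_integral distributed_iso_normal_inner) auto
  also have "\<dots> = (\<integral>\<^sup>+x. ennreal (exp (- (norm x)\<^sup>2) / sqrt pi ^ d) * ennreal (\<bar>x \<bullet> u\<bar> ^ n) \<partial>lborel)"
    unfolding iso_normal_def by (subst nn_integral_density) (simp_all add: prod_normal_density d_def)
  also have "\<dots> = (\<integral>\<^sup>+x. ennreal (\<bar>sgn x \<bullet> u\<bar> ^ n) * h (norm x) \<partial>lborel)"
  proof (intro nn_integral_cong)
    fix x :: 'a
    have "x \<bullet> u = norm x * (sgn x \<bullet> u)"
      by (cases "x = 0") (simp_all add: sgn_div_norm)
    then have "\<bar>x \<bullet> u\<bar> ^ n = norm x ^ n * \<bar>sgn x \<bullet> u\<bar> ^ n"
      by (simp add: abs_mult power_mult_distrib)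
    then show "ennreal (exp (- (norm x)\<^sup>2) / sqrt pi ^ d) * ennreal (\<bar>x \<bullet> u\<bar> ^ n) =
        ennreal (\<bar>sgn x \<bullet> u\<bar> ^ n) * h (norm x)"
      by (simp add: h_def ennreal_mult''[symmetric] mult_ac)
  qed
  also have "\<dots> = I * (\<integral>\<^sup>+r. ennreal (d * r ^ (d - 1)) * h r * indicator {0..} r \<partial>lborel)"
    using fin unfolding I_def d_def
    by (intro nn_integral_polar) (simp_all add: sgn_scaleR)
  also have "(\<integral>\<^sup>+r. ennreal (d * r ^ (d - 1)) * h r * indicator {0..} r \<partial>lborel) =
      (\<integral>\<^sup>+r. ennreal (d / sqrt pi ^ d) * (ennreal (exp (- r\<^sup>2) * r ^ (n + d - 1)) * indicator {0..} r) \<partial>lborel)"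
  proof (intro nn_integral_cong)
    fix r :: real
    \<comment> \<open>With moment index \<open>n + d - 1\<close> the Gamma argument becomes
      \<open>(n + d) / 2\<close>; \<open>d > 0\<close> makes the truncated subtraction
      exact.\<close>
    have "r ^ (n + d - 1) = r ^ n * r ^ (d - 1)"
      using d by (simp flip: power_add)
    then show "ennreal (d * r ^ (d - 1)) * h r * indicator {0..} r =
        ennreal (d / sqrt pi ^ d) * (ennreal (exp (- r\<^sup>2) * r ^ (n + d - 1)) * indicator {0..} r)"
      by (auto simp: indicator_def h_def ennreal_mult''[symmetric] mult_ac)
  qed
  also have "\<dots> = ennreal (d / sqrt pi ^ d * (Gamma ((real n + d) / 2) / 2))"
    using d by (subst nn_integral_cmult)
      (simp_all add: nn_integral_gaussian_half_moment of_nat_diff ennreal_mult'[symmetric] add_ac)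
  finally have eq: "ennreal (Gamma ((real n + 1) / 2) / sqrt pi) =
      I * ennreal (d / sqrt pi ^ d * (Gamma ((real n + d) / 2) / 2))" .
  have pos: "0 < Gamma ((real n + d) / 2)"
    using d by (intro Gamma_real_pos) simp
  obtain i where i: "I = ennreal i" "0 \<le> i"
    using fin by (cases I) auto
  have "Gamma ((real n + 1) / 2) / sqrt pi = i * (d / sqrt pi ^ d * (Gamma ((real n + d) / 2) / 2))"
    using eq i pos by (simp add: ennreal_mult'[symmetric] Gamma_real_nonneg)
  then have "i = 2 * sqrt pi ^ d / (sqrt pi * d) * (Gamma ((real n + 1) / 2) / Gamma ((real n + d) / 2))"
    using d less_imp_neq[OF pos] by (simp add: field_simps)
  then show ?thesis
    using i by (simp add: I_def d_def)
qed

section \<open>Moments of the uniform distribution on the sphere\<close>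

text \<open>Integrals pull back along \<open>sgn\<close> to the ball; restricting to the sphere
  removes only the origin, a null set.\<close>

lemma nn_integral_uniform_sphere:
  fixes g :: "'a::euclidean_space \<Rightarrow> ennreal"
  assumes [measurable]: "g \<in> borel_measurable borel"
  shows "(\<integral>\<^sup>+\<xi>. g \<xi> \<partial>uniform_sphere) =
    (\<integral>\<^sup>+x. g (sgn x) * indicator (ball 0 1) x \<partial>lborel) / emeasure lborel (ball 0 1 :: 'a set)"
proof -
  have [measurable]: "sphere 0 1 \<in> sets (borel :: 'a measure)"
    by (intro borel_closed closed_sphere)
  have "(\<integral>\<^sup>+\<xi>. g \<xi> \<partial>uniform_sphere) =
      (\<integral>\<^sup>+\<xi>. g \<xi> * indicator (sphere 0 1) \<xi> \<partial>distr (uniform_measure lborel (ball 0 1)) borel sgn)"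
    unfolding uniform_sphere_def by (intro nn_integral_restrict_space) simp
  also have "\<dots> = (\<integral>\<^sup>+x. g (sgn x) * indicator (sphere 0 1) (sgn x) \<partial>uniform_measure lborel (ball 0 1))"
    by (intro nn_integral_distr) simp_all
  also have "\<dots> = (\<integral>\<^sup>+x. g (sgn x) * indicator (sphere 0 1) (sgn x) * indicator (ball 0 1) x \<partial>lborel) /
        emeasure lborel (ball 0 1 :: 'a set)"
    by (intro nn_integral_uniform_measure) simp_all
  also have "(\<integral>\<^sup>+x. g (sgn x) * indicator (sphere 0 1) (sgn x) * indicator (ball 0 1) x \<partial>lborel) =
      (\<integral>\<^sup>+x. g (sgn x) * indicator (ball 0 1) x \<partial>lborel)"
    by (intro nn_integral_cong_AE eventually_mono[OF AE_lborel_singleton[of 0]])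
      (auto simp: indicator_def norm_sgn)
  finally show ?thesis .
qed

text \<open>The moment \<open>c n\<close> of the outline in dimension \<open>d\<close>; its
  reciprocal is the factor taking \<open>a n\<close> to \<open>b n\<close>.\<close>

definition sphere_moment :: "nat \<Rightarrow> nat \<Rightarrow> real" where
  "sphere_moment d n =
     Gamma (real d / 2) * Gamma ((real n + 1) / 2) / (sqrt pi * Gamma ((real n + real d) / 2))"

lemma sphere_moment_pos: "0 < d \<Longrightarrow> 0 < sphere_moment d n"
  unfolding sphere_moment_def by (intro divide_pos_pos mult_pos_pos Gamma_real_pos) auto

text \<open>The ball integral is divided by the volume of the ball, and the common factor
  \<open>C\<close>, independent of \<open>n\<close>, cancels.\<close>

lemma nn_integral_uniform_sphere_inner_power:
  fixes u :: "'a::euclidean_space"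
  assumes u: "norm u = 1"
  shows "(\<integral>\<^sup>+\<xi>. ennreal (\<bar>\<xi> \<bullet> u\<bar> ^ n) \<partial>uniform_sphere) = ennreal (sphere_moment DIM('a) n)"
proof -
  define C where "C = 2 * sqrt pi ^ DIM('a) / (sqrt pi * DIM('a))"
  have C: "0 < C" by (simp add: C_def)
  have Gd: "0 < Gamma (DIM('a) / 2)" and Gn: "0 < Gamma ((real n + DIM('a)) / 2)" and G1: "0 < Gamma ((real n + 1) / 2)"
    by (auto intro!: Gamma_real_pos add_nonneg_pos)
  \<comment> \<open>The volume is the case \<open>n = 0\<close> of the same ball integral.\<close>
  have vol: "emeasure lborel (ball 0 1 :: 'a set) = ennreal (C * (sqrt pi / Gamma (DIM('a) / 2)))"
    using nn_integral_ball_sgn_inner_power[OF u, of 0] by (simp add: C_def Gamma_one_half_real)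
  have "(\<integral>\<^sup>+\<xi>. ennreal (\<bar>\<xi> \<bullet> u\<bar> ^ n) \<partial>uniform_sphere) =
      ennreal (C * (Gamma ((real n + 1) / 2) / Gamma ((real n + DIM('a)) / 2))) /
      ennreal (C * (sqrt pi / Gamma (DIM('a) / 2)))"
    by (subst nn_integral_uniform_sphere)
      (simp_all add: nn_integral_ball_sgn_inner_power[OF u] vol C_def)
  also have "\<dots> = ennreal (C * (Gamma ((real n + 1) / 2) / Gamma ((real n + DIM('a)) / 2)) /
      (C * (sqrt pi / Gamma (DIM('a) / 2))))"
    using C Gd Gn G1 by (intro divide_ennreal) auto
  also have "\<dots> = ennreal (sphere_moment DIM('a) n)"
    using C Gd Gn by (simp add: sphere_moment_def field_simps)
  finally show ?thesis .
qed

text \<open>Homogeneity in \<open>z\<close> reduces the claim to a unit vector; if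
  \<open>z = 0\<close>, any unit vector serves as its direction.\<close>

lemma has_bochner_integral_uniform_sphere_inner_power:
  fixes z :: "'a::euclidean_space"
  shows "has_bochner_integral uniform_sphere (\<lambda>\<xi>. \<bar>\<xi> \<bullet> z\<bar> ^ n) (sphere_moment DIM('a) n * norm z ^ n)"
proof -
  obtain u :: 'a where u: "norm u = 1" "z = norm z *\<^sub>R u"
  proof (cases "z = 0")
    case True
    then show ?thesis using that[of "SOME b. b \<in> Basis"] by (simp add: SOME_Basis)
  next
    case False
    then show ?thesis using that[of "sgn z"] by (simp add: norm_sgn sgn_div_norm)
  qed
  have [measurable]: "(\<lambda>\<xi>. \<bar>\<xi> \<bullet> u\<bar> ^ n) \<in> borel_measurable uniform_sphere"
    unfolding measurable_cong_sets[OF sets_uniform_sphere refl]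
    by (intro measurable_restrict_space1) simp
  have "has_bochner_integral uniform_sphere (\<lambda>\<xi>. \<bar>\<xi> \<bullet> u\<bar> ^ n) (sphere_moment DIM('a) n)"
    using sphere_moment_pos[of "DIM('a)" n] nn_integral_uniform_sphere_inner_power[OF u(1), of n]
    by (intro has_bochner_integral_nn_integral) auto
  then have "has_bochner_integral uniform_sphere (\<lambda>\<xi>. \<bar>\<xi> \<bullet> u\<bar> ^ n * norm z ^ n) (sphere_moment DIM('a) n * norm z ^ n)"
    by (rule has_bochner_integral_mult_left)
  moreover have "\<bar>\<xi> \<bullet> u\<bar> ^ n * norm z ^ n = \<bar>\<xi> \<bullet> z\<bar> ^ n" for \<xi>
    by (subst (2) u(2)) (simp add: abs_mult power_mult_distrib)
  ultimately show ?thesis by simp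
qed

section \<open>Lower bound for the moments\<close>

lemma sphere_moment_ge_power:
  "sphere_moment DIM('a::euclidean_space) 1 ^ n \<le> sphere_moment DIM('a) n"
proof -
  interpret prob_space "uniform_sphere :: 'a measure"
    by (rule prob_space_uniform_sphere)
  define u :: 'a where "u = (SOME b. b \<in> Basis)"
  have u: "norm u = 1" by (simp add: u_def SOME_Basis)
  note m = has_bochner_integral_uniform_sphere_inner_power[of u, unfolded u has_bochner_integral_iff, simplified]
  \<comment> \<open>The library's Jensen inequality wants an open interval, so t^n is extended by 0 to negative t.\<close>
  have convex: "convex_on {0::real..} (\<lambda>x. x ^ n)"
    by (cases "even n") (auto intro: convex_power_odd convex_on_subset[OF convex_power_even])
  have "max 0 (expectation (\<lambda>\<xi>. \<bar>\<xi> \<bullet> u\<bar>)) ^ n \<le> expectation (\<lambda>\<xi>. max 0 \<bar>\<xi> \<bullet> u\<bar> ^ n)"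
  proof (rule jensens_inequality[where I = UNIV])
    \<comment> \<open>\<open>max 0\<close> is convex, and on nonnegative reals the power is
      increasing and convex, so the composition is convex.\<close>
    show "convex_on UNIV (\<lambda>x::real. max 0 x ^ n)"
    proof (intro convex_onI)
      fix t x y :: real assume t: "0 < t" "t < 1"
      have "max 0 ((1 - t) * x + t * y) \<le> (1 - t) * max 0 x + t * max 0 y"
        using t by (auto intro!: add_nonneg_nonneg add_mono mult_left_mono)
      then have "max 0 ((1 - t) * x + t * y) ^ n \<le> ((1 - t) * max 0 x + t * max 0 y) ^ n"
        by (intro power_mono) auto
      also have "\<dots> \<le> (1 - t) * max 0 x ^ n + t * max 0 y ^ n"
        using convex_onD[OF convex, of t "max 0 x" "max 0 y"] t by simp
      finally show "max 0 ((1 - t) *\<^sub>R x + t *\<^sub>R y) ^ n \<le> (1 - t) * max 0 x ^ n + t * max 0 y ^ n"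
        by simp
    qed simp
  qed (use m[of 1] m[of n] in simp_all)
  then show ?thesis
    using m[of 1] m[of n] sphere_moment_pos[of "DIM('a)" 1] by simp
qed

section \<open>Termwise integration of the power series\<close>

theorem theorem2p3:
  fixes K :: "real ^ 'd \<Rightarrow> real ^ 'd \<Rightarrow> real"
    and F :: "real \<Rightarrow> real"
    and k :: "real \<Rightarrow> real \<Rightarrow> real"
    and f :: "real \<Rightarrow> real"
    and a b :: "nat \<Rightarrow> real"
  assumes "radial_kernel K F"
    and "\<And>x. 0 \<le> x \<Longrightarrow> (\<lambda>n. a n * x ^ n) sums F x"
    and "\<And>n. b n = sqrt pi * Gamma ((real n + real CARD('d)) / 2)
                  / (Gamma (real CARD('d) / 2) * Gamma ((real n + 1) / 2)) * a n"
    and "\<And>x. 0 \<le> x \<Longrightarrow> f x = (\<Sum>n. b n * x ^ n)"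
    and "radial_kernel k f"
  shows "(\<forall>x::real. summable (\<lambda>n. b n * x ^ n)) \<and>
         (\<forall>x y. integrable uniform_sphere (\<lambda>\<xi>. k (\<xi> \<bullet> x) (\<xi> \<bullet> y)) \<and>
                K x y = prob_space.expectation uniform_sphere (\<lambda>\<xi>. k (\<xi> \<bullet> x) (\<xi> \<bullet> y)))"
proof -
  define c where "c = sphere_moment CARD('d)"
  have c: "0 < c n" for n
    by (simp add: c_def sphere_moment_pos)
  have c1: "c 1 ^ n \<le> c n" for n
    using sphere_moment_ge_power[where 'a = "real ^ 'd", of n] by (simp add: c_def)
  have b: "b n = a n / c n" for n
    using assms(3)[of n] by (simp add: c_def sphere_moment_def)
  \<comment> \<open>Convergence at the larger point \<open>\<bar>x\<bar> + 1\<close> forces absolute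
    convergence at \<open>x\<close>.\<close>
  have a_abs: "summable (\<lambda>n. norm (a n * x ^ n))" for x
  proof (rule powser_insidea)
    show "summable (\<lambda>n. a n * (\<bar>x\<bar> + 1) ^ n)"
      using assms(2)[of "\<bar>x\<bar> + 1"] by (simp add: sums_iff)
  qed simp
  have b_abs: "summable (\<lambda>n. norm (b n * x ^ n))" for x
  proof (rule summable_comparison_test'[OF a_abs[of "x / c 1"], of 0])
    fix n :: nat
    have "norm (b n * x ^ n) = \<bar>a n\<bar> * \<bar>x\<bar> ^ n / c n"
      using c[of n] by (simp add: b abs_mult power_abs)
    also have "\<dots> \<le> \<bar>a n\<bar> * \<bar>x\<bar> ^ n / c 1 ^ n"
      using c[of n] c[of 1] c1[of n] by (intro divide_left_mono) auto
    finally show "norm (norm (b n * x ^ n)) \<le> norm (a n * (x / c 1) ^ n)"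
      using c[of 1] by (simp add: abs_mult power_abs power_divide)
  qed
  have "integrable uniform_sphere (\<lambda>\<xi>. k (\<xi> \<bullet> x) (\<xi> \<bullet> y)) \<and>
      K x y = (\<integral>\<xi>. k (\<xi> \<bullet> x) (\<xi> \<bullet> y) \<partial>uniform_sphere)" for x y
  proof -
    define z where "z = x - y"
    have k: "k (\<xi> \<bullet> x) (\<xi> \<bullet> y) = (\<Sum>n. b n * \<bar>\<xi> \<bullet> z\<bar> ^ n)" for \<xi>
      using assms(4)[of "\<bar>\<xi> \<bullet> z\<bar>"] assms(5) by (simp add: radial_kernel_def z_def inner_diff_right)
    \<comment> \<open>The free factor \<open>g\<close> is taken as \<open>b n\<close> for the values
      and as \<open>\<bar>b n\<bar>\<close> for the norms of the terms.\<close>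
    have m: "has_bochner_integral uniform_sphere (\<lambda>\<xi>. g * \<bar>\<xi> \<bullet> z\<bar> ^ n) (g * (c n * norm z ^ n))" for n g
      using has_bochner_integral_uniform_sphere_inner_power[of z n]
      by (intro has_bochner_integral_mult_right) (simp add: c_def)
    have int: "integrable uniform_sphere (\<lambda>\<xi>. b n * \<bar>\<xi> \<bullet> z\<bar> ^ n)" for n
      using m[of "b n" n] by (simp add: has_bochner_integral_iff)
    have AE: "AE \<xi> in uniform_sphere. summable (\<lambda>n. norm (b n * \<bar>\<xi> \<bullet> z\<bar> ^ n))"
      using b_abs by (intro AE_I2) auto
    \<comment> \<open>The moment \<open>c n\<close> cancels the denominator of \<open>b n\<close>,
      so the integrated norms are the terms of the absolutely convergent series of
      \<open>F\<close>.\<close>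
    have "(\<integral>\<xi>. norm (b n * \<bar>\<xi> \<bullet> z\<bar> ^ n) \<partial>uniform_sphere) = norm (a n * norm z ^ n)" for n
      using m[of "\<bar>b n\<bar>" n] c[of n] by (simp add: has_bochner_integral_iff b abs_mult)
    then have sm: "summable (\<lambda>n. \<integral>\<xi>. norm (b n * \<bar>\<xi> \<bullet> z\<bar> ^ n) \<partial>uniform_sphere)"
      using a_abs by simp
    have "(\<integral>\<xi>. b n * \<bar>\<xi> \<bullet> z\<bar> ^ n \<partial>uniform_sphere) = a n * norm z ^ n" for n
      using m[of "b n" n] c[of n] by (simp add: has_bochner_integral_iff b)
    \<comment> \<open>Dominated convergence exchanges sum and integral; the resulting series is that
      of \<open>F\<close> at \<open>norm z\<close>.\<close>
    then have "(\<lambda>n. a n * norm z ^ n) sums (\<integral>\<xi>. k (\<xi> \<bullet> x) (\<xi> \<bullet> y) \<partial>uniform_sphere)"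
      using sums_integral[OF int AE sm] by (simp add: k)
    moreover have "(\<lambda>n. a n * norm z ^ n) sums K x y"
      using assms(1) assms(2)[of "norm z"] by (simp add: radial_kernel_def z_def)
    ultimately show ?thesis
      using integrable_suminf[OF int AE sm] by (simp add: k sums_unique2)
  qed
  then show ?thesis
    using summable_norm_cancel[OF b_abs] by blast
qed

end
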